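(* Let $\sigma$ be a dyadically linear permutation of $\mathbb{N}_0$. Then $\#A^\sigma_n \le 6^n$ for all $n=0,1,2,\ldots$. Consequently, for every $p\in[1,\infty]$ with $p\neq 2$, the systems $(e_k)_{k\ge 0}$ and $(w_{\sigma(k)})_{k\ge 0}$ are not equivalent in $L_p$. In particular, for every $p\in[1,\infty]$ with $p\neq 2$, neither the Walsh-Paley system nor the original Walsh system is equivalent in $L_p$ to the trigonometric system $(e_k)_{k\ge 0}$.
   Context: $\mathbb{N}_0=\{0,1,2,\ldots\}$ and $[m]=\{0,1,\ldots,m-1\}$; $\#A$ is the cardinality of $A$. For $n\in\mathbb{N}_0$ with binary expansion $n=\sum_{i\ge0} n_i2^i$, $n_i\in\{0,1\}$, the dyadic sum is $m\oplus n=\sum_{i\ge 0}|m_i-n_i|2^i$ (bitwise XOR). On $[0,1]$, $e_n(t)=\exp(2\pi i n t)$; $r_0,r_1,\ldots$ are the Rademacher functions ($r_i(t)=\operatorname{sign}\sin(2^{i+1}\pi t)$), and $w_n=\prod_{i\ge 0} r_i^{n_i}$ is the $n$-th Walsh function (in the Walsh-Paley order). Two systems $(a_k)_{k\ge0}$, $(b_k)_{k\ge0}$ in $L_p[0,1]$ are equivalent in $L_p$ ($1\le p\le\infty$) if there is $c>0$ such that $\frac1c\|\sum_k\xi_k a_k\|_p\le\|\sum_k\xi_k b_k\|_p\le c\|\sum_k\xi_k a_k\|_p$ for all complex sequences $(\xi_k)_{k\ge0}$ with finitely many nonzero terms; $\|\cdot\|_p$ is the norm of $L_p[0,1]$. A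 permutation $\sigma$ of $\mathbb{N}_0$ is dyadically linear if $\sigma(m\oplus n)=\sigma(m)\oplus\sigma(n)$ for all $m,n\in\mathbb{N}_0$; equivalently, there is a matrix $(t_{i,j})_{i,j\ge0}$ with entries in $\{0,1\}$ such that the $i$-th binary digit of $\sigma(n)$ is $\sum_j t_{i,j}n_j \bmod 2$. The Walsh-Paley system is $(w_k)_{k\ge 0}$ (i.e. $\sigma$ is the identity). The original Walsh system is $(w_{\sigma(k)})_{k\ge0}$ where $\sigma$ is given by the matrix with $t_{i,j}=1$ if and only if $j=i$ or $j=i+1$. For a permutation $\sigma$ of $\mathbb{N}_0$, $A^\sigma_n=\{(k,l,m)\in[2^n]^3 : k+l-m\in[2^n],\ \sigma(k)\oplus\sigma(l)\oplus\sigma(m)=\sigma(k+l-m)\}$. *)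

theory Defs
  imports "HOL-Probability.Essential_Supremum"
begin

unbundle bit_operations_syntax

text \<open>
  The dyadic sum on \<^typ>\<open>nat\<close> is the library's bitwise \<open>XOR\<close>, and the binary digit
  \<open>n\<^sub>i\<close> is \<open>bit n i\<close>.
\<close>

definition dyadically_linear :: "(nat \<Rightarrow> nat) \<Rightarrow> bool"
  where "dyadically_linear \<sigma> \<longleftrightarrow> bij \<sigma> \<and> (\<forall>m n. \<sigma> (m XOR n) = \<sigma> m XOR \<sigma> n)"

text \<open>
  The map whose \<open>i\<close>-th binary digit at \<open>n\<close> is \<open>\<Sum>\<^sub>j t\<^sub>i\<^sub>j n\<^sub>j mod 2\<close>. It is meaningful for matrices
  with finitely many nonzero entries in each column, see \<open>bit_dyadic_matrix_map\<close>.
\<close>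

definition dyadic_matrix_map :: "(nat \<Rightarrow> nat \<Rightarrow> nat) \<Rightarrow> nat \<Rightarrow> nat"
  where "dyadic_matrix_map t n = (\<Sum>i | (\<Sum>j | bit n j. t i j) mod 2 = 1. 2 ^ i)"

lemma finite_bits_nat: "finite {j. bit (n::nat) j}"
proof (rule finite_subset)
  show "{j. bit n j} \<subseteq> {..<n}"
  proof clarify
    fix j assume "bit n j"
    then have "n div 2 ^ j \<noteq> 0" by (metis bit_iff_odd even_zero)
    then have "2 ^ j \<le> n" by (metis div_less not_le)
    moreover have "j < 2 ^ j" by (rule less_exp)
    ultimately show "j < n" by linarith
  qed
qed simp

lemma bit_sum_powers: "finite S \<Longrightarrow> bit (\<Sum>i\<in>S. 2 ^ i :: nat) k \<longleftrightarrow> k \<in> S"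
proof (induction S arbitrary: k rule: finite_induct)
  case empty
  then show ?case by simp
next
  case (insert x S)
  have "(2 ^ x :: nat) AND (\<Sum>i\<in>S. 2 ^ i) = 0"
    using insert by (auto intro!: bit_eqI simp: bit_and_iff bit_exp_iff)
  then have "(2 ^ x :: nat) + (\<Sum>i\<in>S. 2 ^ i) = 2 ^ x OR (\<Sum>i\<in>S. 2 ^ i)"
    by (simp add: disjunctive_add_eq_or)
  with insert show ?case by (auto simp: bit_or_iff bit_exp_iff)
qed

lemma bit_dyadic_matrix_map:
  assumes "\<And>j. finite {i. t i j \<noteq> 0}"
  shows "bit (dyadic_matrix_map t n) i \<longleftrightarrow> (\<Sum>j | bit n j. t i j) mod 2 = 1"
proof -
  have "{i. (\<Sum>j | bit n j. t i j) mod 2 = 1} \<subseteq> (\<Union>j\<in>{j. bit n j}. {i. t i j \<noteq> 0})"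
    by (auto intro: ccontr)
  then have "finite {i. (\<Sum>j | bit n j. t i j) mod 2 = 1}"
    by (rule finite_subset) (use assms finite_bits_nat in auto)
  then show ?thesis
    unfolding dyadic_matrix_map_def by (subst bit_sum_powers) auto
qed

definition original_walsh_perm :: "nat \<Rightarrow> nat"
  where "original_walsh_perm = dyadic_matrix_map (\<lambda>i j. of_bool (j = i \<or> j = i + 1))"

lemma bit_original_walsh_perm:
  "bit (original_walsh_perm n) i \<longleftrightarrow> bit n i \<noteq> bit n (i + 1)"
proof -
  have fin: "finite {i. (of_bool (j = i \<or> j = i + 1) :: nat) \<noteq> 0}" for j :: nat
    by (rule finite_subset[of _ "{..j}"]) auto
  have "(\<Sum>j | bit n j. of_bool (j = i \<or> j = i + 1)) = card ({j. bit n j} \<inter> {i, i + 1})"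
    by (subst sum_of_bool_eq) (auto simp: finite_bits_nat intro!: arg_cong[where f = card])
  also have "{j. bit n j} \<inter> {i, i + 1} =
      (if bit n i then {i} else {}) \<union> (if bit n (i + 1) then {i + 1} else {})"
    by auto
  finally show ?thesis
    unfolding original_walsh_perm_def by (subst bit_dyadic_matrix_map[OF fin]) auto
qed

definition A_set :: "(nat \<Rightarrow> nat) \<Rightarrow> nat \<Rightarrow> (nat \<times> nat \<times> nat) set"
  where "A_set \<sigma> n = {(k, l, m). k < 2 ^ n \<and> l < 2 ^ n \<and> m < 2 ^ n
    \<and> m \<le> k + l \<and> k + l - m < 2 ^ n \<and> \<sigma> k XOR \<sigma> l XOR \<sigma> m = \<sigma> (k + l - m)}"

definition trig :: "nat \<Rightarrow> real \<Rightarrow> complex"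
  where "trig n t = exp (2 * of_real pi * \<i> * of_nat n * of_real t)"

definition rademacher :: "nat \<Rightarrow> real \<Rightarrow> real"
  where "rademacher i t = sgn (sin (2 ^ (i + 1) * pi * t))"

definition walsh :: "nat \<Rightarrow> real \<Rightarrow> complex"
  where "walsh n t = (\<Prod>i | bit n i. complex_of_real (rademacher i t))"

text \<open>
  The norm of \<open>L\<^sub>p[0,1]\<close> for \<open>1 \<le> p \<le> \<infinity>\<close>. It is real-valued, hence meaningful only for
  functions in \<open>L\<^sub>p[0,1]\<close>; it is applied below to linear combinations of bounded measurable
  functions.
\<close>

definition Lp_norm :: "ereal \<Rightarrow> (real \<Rightarrow> complex) \<Rightarrow> real"
  where "Lp_norm p f =
    (if p = \<infinity> then real_of_ereal (esssup (lebesgue_on {0..1}) (\<lambda>t. ereal (norm (f t))))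
     else (LINT t|lebesgue_on {0..1}. norm (f t) powr real_of_ereal p) powr (1 / real_of_ereal p))"

definition Lp_equivalent :: "ereal \<Rightarrow> (nat \<Rightarrow> real \<Rightarrow> complex) \<Rightarrow> (nat \<Rightarrow> real \<Rightarrow> complex) \<Rightarrow> bool"
  where "Lp_equivalent p a b \<longleftrightarrow> (\<exists>c>0. \<forall>\<xi> :: nat \<Rightarrow> complex. finite {k. \<xi> k \<noteq> 0} \<longrightarrow>
    (1 / c) * Lp_norm p (\<lambda>t. \<Sum>k | \<xi> k \<noteq> 0. \<xi> k * a k t)
      \<le> Lp_norm p (\<lambda>t. \<Sum>k | \<xi> k \<noteq> 0. \<xi> k * b k t) \<and>
    Lp_norm p (\<lambda>t. \<Sum>k | \<xi> k \<noteq> 0. \<xi> k * b k t)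
      \<le> c * Lp_norm p (\<lambda>t. \<Sum>k | \<xi> k \<noteq> 0. \<xi> k * a k t))"

text \<open>The systems considered belong to every \<open>L\<^sub>p[0,1]\<close>.\<close>

lemma norm_trig: "norm (trig n t) = 1"
  by (simp add: trig_def)

lemma norm_walsh_le_1: "norm (walsh n t) \<le> 1"
  unfolding walsh_def prod_norm[symmetric]
  by (rule prod_le_1) (auto simp: rademacher_def sgn_if)

lemma measurable_trig: "trig n \<in> borel_measurable (lebesgue_on {0..1})"
  by (rule continuous_imp_measurable_on_sets_lebesgue)
     (auto simp: trig_def intro!: continuous_intros)

lemma measurable_rademacher: "rademacher i \<in> borel_measurable borel"
  unfolding rademacher_def by measurable

lemma measurable_walsh: "walsh n \<in> borel_measurable (lebesgue_on {0..1})"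
proof -
  have "walsh n \<in> borel_measurable borel"
    unfolding walsh_def
    by (intro borel_measurable_prod measurable_compose[OF measurable_rademacher]) simp
  then have "walsh n \<in> borel_measurable lebesgue"
    by (simp add: measurable_completion measurable_lborel1)
  then show ?thesis by (rule measurable_restrict_space1)
qed

end

theory Submission
  imports Defs
begin

text \<open>
  Fix \<open>n\<close> and put \<open>N = 2 ^ n\<close>. The set \<open>{..<N}\<close> is a group under \<open>XOR\<close>, with characters \<open>\<chi>\<^sub>j\<close>,
  \<open>j < N\<close>. The two systems are compared on the coefficients \<open>\<chi>\<^sub>j(k) / N\<close>, that is, through the means
  \<open>V\<^sub>j = (1/N) \<Sum>\<^sub>k \<chi>\<^sub>j(k) w\<^bsub>\<sigma>(k)\<^esub>\<close> and \<open>K\<^sub>j = (1/N) \<Sum>\<^sub>k \<chi>\<^sub>j(k) e\<^sub>k\<close> (both are \<open>character_mean\<close>).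

  On the Walsh side everything is explicit. At a point \<open>t\<close> that is not a dyadic rational,
  \<open>k \<mapsto> \<chi>\<^sub>j(k) w\<^bsub>\<sigma>(k)\<^esub>(t)\<close> is multiplicative for \<open>XOR\<close>, so its mean \<open>V\<^sub>j(t)\<close> is 0 or 1, and
  \<open>\<Sum>\<^sub>j V\<^sub>j(t) = w\<^sub>0(t) = 1\<close>. Hence \<open>\<Sum>\<^sub>j \<integral> \<bar>V\<^sub>j\<bar>\<^sup>p = 1\<close> for all finite \<open>p\<close> (\<open>walsh_moment\<close>). If the systems
  are equivalent in \<open>L\<^sub>p\<close>, then \<open>M\<^sub>p(n) = \<Sum>\<^sub>j \<integral> \<bar>K\<^sub>j\<bar>\<^sup>p\<close> stays between two positive constants as
  \<open>n\<close> grows (\<open>trig_moment_bounds_of_equivalent\<close>).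

  On the trigonometric side \<open>M\<^sub>2(n) = 1\<close> by orthogonality, while \<open>M\<^sub>4(n)\<close> counts the quadruples with
  \<open>k + l = m + q\<close> and \<open>k XOR l = m XOR q\<close>, divided by \<open>N\<^sup>3\<close>. These two equations force the digits of
  the quadruple to satisfy \<open>k\<^sub>i + l\<^sub>i = m\<^sub>i + q\<^sub>i\<close> in each place (\<open>add_xor_halves\<close>), which leaves
  six possibilities per place. So there are at most \<open>6 ^ n\<close> such quadruples (\<open>card_A_set_id\<close>), and
  linearity and injectivity of \<open>\<sigma>\<close> give the same bound for \<open>A_set \<sigma> n\<close>. Thus \<open>M\<^sub>4(n) \<le> (3/4) ^ n\<close>
  (\<open>fourth_moment\<close>).

  Since \<open>M\<^sub>4(n)\<close> tends to 0 and \<open>M\<^sub>2(n) = 1\<close>, elementary interpolation shows that \<open>M\<^sub>p(n)\<close> is unbounded for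
  \<open>1 \<le> p < 2\<close> and comes arbitrarily close to 0 for \<open>p > 2\<close>, which settles all finite \<open>p \<noteq> 2\<close>. For \<open>p = \<infinity>\<close>,
  the \<open>V\<^sub>j\<close> are a partition of unity, so combinations of them with
  coefficients of modulus at most 1 are bounded by 1; equivalence in
  \<open>L\<^sub>\<infinity>\<close> transfers this to the \<open>K\<^sub>j\<close>, and choosing the phases at a given point bounds \<open>\<Sum>\<^sub>j \<bar>K\<^sub>j\<bar>\<close> there. So
  \<open>M\<^sub>1(n)\<close> is bounded, which has been excluded
  (\<open>trig_moment_1_bound_of_equivalent_infinity\<close>).
\<close>

section \<open>Characters of the dyadic group\<close>

text \<open>
  Both Walsh functions and characters of the group of natural numbers under \<open>XOR\<close> are products of
  signs \<open>r i\<close> over the binary digits of the index; multiplicativity is proved once for both.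
\<close>

definition bit_product :: "(nat \<Rightarrow> 'a) \<Rightarrow> nat \<Rightarrow> 'a::comm_monoid_mult"
  where "bit_product r n = (\<Prod>i | bit n i. r i)"

lemma bit_product_xor:
  assumes r: "\<And>i. r i * r i = 1"
  shows "bit_product r (m XOR n) = bit_product r m * bit_product r n"
proof -
  let ?A = "{i. bit m i}" and ?B = "{i. bit n i}"
  have fin: "finite ?A" "finite ?B"
    by (rule finite_bits_nat)+
  have A: "prod r ?A = prod r (?A - ?B) * prod r (?A \<inter> ?B)"
    using fin by (subst prod.union_disjoint [symmetric]) (auto intro!: prod.cong)
  have B: "prod r ?B = prod r (?B - ?A) * prod r (?A \<inter> ?B)"
    using fin by (subst prod.union_disjoint [symmetric]) (auto intro!: prod.cong)
  have sq: "prod r (?A \<inter> ?B) * prod r (?A \<inter> ?B) = 1"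
    by (simp add: prod.distrib [symmetric] r)
  have "{i. bit (m XOR n) i} = (?A - ?B) \<union> (?B - ?A)"
    by (auto simp: bit_xor_iff)
  then have "bit_product r (m XOR n) = prod r (?A - ?B) * prod r (?B - ?A)"
    using fin by (simp add: bit_product_def) (subst prod.union_disjoint, auto)
  also have "\<dots> = prod r ?A * prod r ?B"
    unfolding A B using sq by (metis (no_types, lifting) mult.assoc mult.left_commute mult.right_neutral)
  finally show ?thesis
    by (simp add: bit_product_def)
qed

lemma xor_less_power_of_two:
  fixes k l :: nat
  assumes "k < 2 ^ n" "l < 2 ^ n"
  shows "k XOR l < 2 ^ n"
proof -
  have "take_bit n k = k" "take_bit n l = l"
    using assms by (simp_all add: take_bit_nat_eq_self_iff)
  then have "take_bit n (k XOR l) = k XOR l"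
    by simp
  then show ?thesis
    by (metis take_bit_nat_less_exp)
qed

lemma xor_nat_cancel: "(k XOR l) XOR l = (k::nat)"
  by (rule bit_eqI) (auto simp: bit_xor_iff)

lemma bij_betw_xor:
  fixes l :: nat
  assumes "l < 2 ^ n"
  shows "bij_betw (\<lambda>k. k XOR l) {..<2 ^ n} {..<2 ^ n}"
  by (rule bij_betw_byWitness [where f' = "\<lambda>k. k XOR l"])
     (use assms in \<open>auto simp: xor_nat_cancel xor_less_power_of_two\<close>)

text \<open>
  Multiplying by \<open>\<epsilon> l\<close> only permutes the summands, since \<open>k \<mapsto> k XOR l\<close> permutes the subgroup
  \<open>{..<2 ^ n}\<close>.
\<close>

lemma character_sum_absorb:
  fixes \<epsilon> :: "nat \<Rightarrow> 'a::comm_semiring_1"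
  assumes "\<And>k l. \<epsilon> (k XOR l) = \<epsilon> k * \<epsilon> l" "l < 2 ^ n"
  shows "(\<Sum>k<2 ^ n. \<epsilon> k) * \<epsilon> l = (\<Sum>k<2 ^ n. \<epsilon> k)"
  using sum.reindex_bij_betw [OF bij_betw_xor [OF assms(2)], of \<epsilon>]
  by (simp add: assms(1) sum_distrib_right)

text \<open>
  By absorption, the sum \<open>S\<close> satisfies \<open>S\<^sup>2 = 2 ^ n * S\<close>. This lets \<open>\<epsilon>\<close> be a Walsh system
  evaluated at a point, whose values need not be identified.
\<close>

lemma character_sum_dichotomy:
  fixes \<epsilon> :: "nat \<Rightarrow> 'a::idom"
  assumes "\<And>k l. \<epsilon> (k XOR l) = \<epsilon> k * \<epsilon> l"
  shows "(\<Sum>k<2 ^ n. \<epsilon> k) = 0 \<or> (\<Sum>k<2 ^ n. \<epsilon> k) = 2 ^ n"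
proof -
  let ?S = "\<Sum>k<2 ^ n. \<epsilon> k"
  have "?S * ?S = (\<Sum>l\<in>{..<2 ^ n}. ?S * \<epsilon> l)"
    by (simp add: sum_distrib_left)
  also have "\<dots> = (\<Sum>l\<in>{..<2 ^ n :: nat}. ?S)"
    by (rule sum.cong) (simp_all add: character_sum_absorb [OF assms])
  also have "\<dots> = 2 ^ n * ?S"
    by simp
  finally show ?thesis
    by auto
qed

text \<open>
  For \<open>j < 2 ^ n\<close> these are the \<open>2 ^ n\<close> characters of the group \<open>{..<2 ^ n}\<close> under \<open>XOR\<close>;
  the value is \<open>-1\<close> to the number of places where \<open>j\<close> and \<open>k\<close> both have the digit 1.
\<close>

definition dyadic_char :: "nat \<Rightarrow> nat \<Rightarrow> complex"
  where "dyadic_char j k = bit_product (\<lambda>i. if bit j i then - 1 else 1) k"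

lemma dyadic_char_xor: "dyadic_char j (k XOR l) = dyadic_char j k * dyadic_char j l"
  unfolding dyadic_char_def by (rule bit_product_xor) simp

lemma dyadic_char_commute: "dyadic_char j k = dyadic_char k j"
proof -
  have "dyadic_char j k = (- 1) ^ card {i. bit j i \<and> bit k i}" for j k
  proof -
    have "dyadic_char j k = (\<Prod>i\<in>{i. bit k i \<and> bit j i}. - 1)"
      unfolding dyadic_char_def bit_product_def
      by (rule prod.mono_neutral_cong_right) (auto simp: finite_bits_nat)
    then show ?thesis
      by (simp add: conj_commute)
  qed
  then show ?thesis
    by (metis (no_types, lifting) Collect_cong)
qed

lemma dyadic_char_0 [simp]: "dyadic_char j 0 = 1"
  by (simp add: dyadic_char_def bit_product_def)

lemma cnj_dyadic_char [simp]: "cnj (dyadic_char j k) = dyadic_char j k"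
  by (simp add: dyadic_char_def bit_product_def if_distrib cong: if_cong prod.cong)

lemma dyadic_char_square: "dyadic_char j k * dyadic_char j k = 1"
  using dyadic_char_xor [of j k k] by simp

lemma norm_dyadic_char [simp]: "norm (dyadic_char j k) = 1"
  by (simp add: dyadic_char_def bit_product_def prod_norm [symmetric] if_distrib cong: if_cong)

text \<open>
  By symmetry in \<open>j\<close> and \<open>k\<close> this is a character sum over \<open>j\<close>. If \<open>k\<close> has the digit 1 in place \<open>i\<close>,
  absorption of the value \<open>-1\<close> at \<open>2 ^ i\<close> forces the sum to vanish.
\<close>

lemma sum_dyadic_char:
  assumes "k < 2 ^ n"
  shows "(\<Sum>j<2 ^ n. dyadic_char j k) = (if k = 0 then 2 ^ n else 0)"
proof (cases "k = 0")
  case False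
  then obtain i where i: "bit k i"
    by (metis bit_eqI bit_0_eq bot_apply bot_bool_def)
  have "i < n"
    using i assms by (metis bit_take_bit_iff take_bit_nat_eq_self_iff)
  have "dyadic_char k (2 ^ i) = - 1"
    using i by (simp add: dyadic_char_def bit_product_def bit_exp_iff)
  then have "(\<Sum>j<2 ^ n. dyadic_char k j) = 0"
    using character_sum_absorb [of "dyadic_char k" "2 ^ i" n] \<open>i < n\<close>
    by (simp add: dyadic_char_xor)
  then show ?thesis
    using False by (simp add: dyadic_char_commute)
qed simp

lemma dyadic_char_orthogonal:
  assumes "k < 2 ^ n" "l < 2 ^ n"
  shows "(\<Sum>j<2 ^ n. dyadic_char j k * dyadic_char j l) = (if k = l then 2 ^ n else 0)"
proof -
  have "k XOR l = 0 \<longleftrightarrow> k = l"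
    by (metis xor_nat_cancel xor_self_eq xor.left_neutral)
  then show ?thesis
    using sum_dyadic_char [OF xor_less_power_of_two [OF assms]] by (simp add: dyadic_char_xor)
qed

section \<open>Counting the additive quadruples\<close>

text \<open>
  A linear injective \<open>\<sigma>\<close> can be cancelled from the defining equation, so the count is the same for
  all dyadically linear permutations.
\<close>

lemma A_set_dyadically_linear:
  assumes "dyadically_linear \<sigma>"
  shows "A_set \<sigma> n = A_set id n"
proof -
  have "\<sigma> k XOR \<sigma> l XOR \<sigma> m = \<sigma> q \<longleftrightarrow> k XOR l XOR m = q" for k l m q
    using assms unfolding dyadically_linear_def by (metis bij_def inj_eq)
  then show ?thesis
    by (simp add: A_set_def)
qed

lemma finite_A_set: "finite (A_set \<sigma> n)"
  by (rule finite_subset [of _ "{..<2 ^ n} \<times> {..<2 ^ n} \<times> {..<2 ^ n}"]) (auto simp: A_set_def)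

lemma xor_mod_2_nat: "(k XOR l) mod 2 = (k + l) mod (2::nat)"
  by (metis (no_types) even_add even_xor_iff odd_iff_mod_2_eq_one even_iff_mod_2_eq_zero)

lemma xor_div_2_nat: "(k XOR l) div 2 = (k div 2) XOR (l div (2::nat))"
  using drop_bit_xor [of 1 k l] by (simp only: drop_bit_eq_div power_one_right)

text \<open>
  If ordinary and dyadic sums agree, so do the digit sums in the last place, hence the carries: digit
  sums of equal parity differ only if one is 0 and the other is 2, and then the sums of the halves
  would differ by one, although their parities are determined by equal dyadic sums.
\<close>

lemma add_xor_halves:
  fixes k l m q :: nat
  assumes add: "k + l = m + q" and xor: "k XOR l = m XOR q"
  shows "k div 2 + l div 2 = m div 2 + q div 2" "k mod 2 + l mod 2 = m mod 2 + q mod 2"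
proof -
  have "k div 2 XOR l div 2 = m div 2 XOR q div 2"
    by (metis xor xor_div_2_nat)
  then have "(k div 2 + l div 2) mod 2 = (m div 2 + q div 2) mod 2"
    by (metis xor_mod_2_nat)
  moreover have "2 * (k div 2 + l div 2) + (k mod 2 + l mod 2) =
      2 * (m div 2 + q div 2) + (m mod 2 + q mod 2)"
    using add by (simp add: algebra_simps)
  moreover have "k mod 2 + l mod 2 \<le> 2" "m mod 2 + q mod 2 \<le> 2"
    by linarith+
  moreover have "S = T \<and> u = v"
    if "S mod 2 = T mod 2" "2 * S + u = 2 * T + v" "u \<le> 2" "v \<le> 2" for S T u v :: nat
  proof -
    have "S = T \<or> S = Suc T \<or> T = Suc S"
      using that(2-4) by linarith
    then have "S = T"
      using that(1) by (auto simp: mod_Suc split: if_splits)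
    then show ?thesis
      using that(2) by simp
  qed
  ultimately show "k div 2 + l div 2 = m div 2 + q div 2" "k mod 2 + l mod 2 = m mod 2 + q mod 2"
    by blast+
qed

text \<open>
  Naming the fourth member \<open>q = k + l - m\<close> removes the truncated subtraction.
\<close>

lemma A_set_id_iff:
  "(k, l, m) \<in> A_set id n \<longleftrightarrow>
     k < 2 ^ n \<and> l < 2 ^ n \<and> m < 2 ^ n \<and>
     (\<exists>q<2 ^ n. k + l = m + q \<and> k XOR l = m XOR q)"
proof -
  have eq: "k XOR l XOR m = q \<longleftrightarrow> k XOR l = m XOR q" for q
    by (metis xor.commute xor_nat_cancel xor.assoc)
  have "m \<le> k + l \<and> k + l - m < 2 ^ n \<and> P (k + l - m) \<longleftrightarrow> (\<exists>q<2 ^ n. k + l = m + q \<and> P q)"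
    (is "?L \<longleftrightarrow> ?R") for P
  proof
    assume ?L
    then show ?R
      by (intro exI [of _ "k + l - m"]) simp
  next
    assume ?R
    then show ?L
      by auto
  qed
  from this [of "\<lambda>q. k XOR l = m XOR q"] show ?thesis
    by (simp only: A_set_def mem_Collect_eq prod.case id_apply eq)
qed

text \<open>
  Splitting off the last digits maps the triples of length \<open>n + 1\<close> injectively to a triple of length
  \<open>n\<close> and three digits \<open>a, b, c\<close> with \<open>a + b - c\<close> again a digit; there are six of the latter.
\<close>

lemma card_A_set_id: "card (A_set id n) \<le> 6 ^ n"
proof (induction n)
  case 0
  have "A_set id 0 \<subseteq> {(0, 0, 0)}"
    by (auto simp: A_set_def)
  then show ?case
    using card_mono [of "{(0, 0, 0)}" "A_set id 0"] by (simp add: id_def)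
next
  case (Suc n)
  define S :: "(nat \<times> nat \<times> nat) set"
    where "S = {(0,0,0), (1,1,1), (0,1,0), (0,1,1), (1,0,0), (1,0,1)}"
  define h :: "nat \<times> nat \<times> nat \<Rightarrow> (nat \<times> nat \<times> nat) \<times> (nat \<times> nat \<times> nat)"
    where "h = (\<lambda>(k, l, m). ((k div 2, l div 2, m div 2), (k mod 2, l mod 2, m mod 2)))"
  have "inj h"
    by (rule inj_on_inverseI
          [where g = "\<lambda>((a, b, c), (x, y, z)). (a * 2 + x, b * 2 + y, c * 2 + z)"])
       (simp add: h_def split: prod.split)
  have "h ` A_set id (Suc n) \<subseteq> A_set id n \<times> S"
  proof clarify
    fix k l m a b
    assume mem: "(k, l, m) \<in> A_set id (Suc n)" and ab: "(a, b) = h (k, l, m)"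
    then obtain q where q: "q < 2 ^ Suc n" "k + l = m + q" "k XOR l = m XOR q"
      by (auto simp: A_set_id_iff)
    note halves = add_xor_halves [OF q(2,3)]
    have "k div 2 XOR l div 2 = m div 2 XOR q div 2"
      by (metis q(3) xor_div_2_nat)
    then have "a \<in> A_set id n"
      using mem q halves(1) ab by (auto simp: A_set_id_iff h_def intro!: exI [of _ "q div 2"])
    moreover have "b \<in> S"
    proof -
      have "(x, y, z) \<in> S" if "x < 2" "y < 2" "z < 2" "w < 2" "x + y = z + w" for x y z w
        using that by (auto simp: S_def less_2_cases_iff)
      from this [OF _ _ _ _ halves(2)] show ?thesis
        using ab by (simp add: h_def)
    qed
    ultimately show "a \<in> A_set id n \<and> b \<in> S" ..
  qed
  then have "card (A_set id (Suc n)) \<le> card (A_set id n \<times> S)"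
    by (intro card_inj_on_le [of h]) (auto intro: inj_on_subset [OF \<open>inj h\<close>] finite_A_set simp: S_def)
  also have "\<dots> = card (A_set id n) * 6"
    by (simp add: card_cartesian_product S_def)
  finally show ?case
    using Suc unfolding power_Suc by linarith
qed

section \<open>Character means of the two systems\<close>

text \<open>
  The coefficient sequences on which the two systems are compared: the characters, scaled by
  \<open>2 ^ -n\<close> so that the Walsh means become indicator functions of a partition.
\<close>

definition character_mean :: "nat \<Rightarrow> (nat \<Rightarrow> real \<Rightarrow> complex) \<Rightarrow> nat \<Rightarrow> real \<Rightarrow> complex"
  where "character_mean n a j t = (\<Sum>k<2 ^ n. dyadic_char j k / 2 ^ n * a k t)"

lemma sum_character_mean: "(\<Sum>j<2 ^ n. character_mean n a j t) = a 0 t"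
proof -
  have "(\<Sum>j<2 ^ n. character_mean n a j t) =
      (\<Sum>k<2 ^ n. (\<Sum>j<2 ^ n. dyadic_char j k) * (a k t / 2 ^ n))"
    unfolding character_mean_def
    by (subst sum.swap) (simp add: sum_distrib_right sum_divide_distrib)
  also have "\<dots> = (\<Sum>k<2 ^ n. if k = 0 then a k t else 0)"
    by (rule sum.cong) (simp_all add: sum_dyadic_char)
  also have "\<dots> = a 0 t"
    by simp
  finally show ?thesis .
qed

text \<open>
  The Rademacher functions vanish at dyadic rationals, where the Walsh functions are not
  multiplicative in the index.
\<close>

lemma AE_sin_nonzero: "AE t in lebesgue_on {0..1}. \<forall>i. sin (2 ^ (i + 1) * pi * t) \<noteq> 0"
proof -
  let ?N = "\<Union>i. range (\<lambda>z. real_of_int z / 2 ^ (i + 1))"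
  have "?N \<in> null_sets lborel"
    by (rule countable_imp_null_set_lborel) auto
  then have "?N \<in> null_sets lebesgue"
    by (rule null_sets_completionI)
  then have "AE t in lebesgue. t \<notin> ?N"
    by (rule AE_not_in)
  then have "AE t in lebesgue. t \<in> {0..1} \<longrightarrow> (\<forall>i. sin (2 ^ (i + 1) * pi * t) \<noteq> 0)"
  proof (rule eventually_mono)
    fix t assume "t \<notin> ?N"
    show "t \<in> {0..1} \<longrightarrow> (\<forall>i. sin (2 ^ (i + 1) * pi * t) \<noteq> 0)"
    proof (intro impI allI notI)
      fix i assume "sin (2 ^ (i + 1) * pi * t) = 0"
      then obtain z where "2 ^ (i + 1) * pi * t = of_int z * pi"
        by (auto simp: sin_zero_iff_int2)
      then have "t = of_int z / 2 ^ (i + 1)"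
        by (simp add: field_simps)
      with \<open>t \<notin> ?N\<close> show False
        by blast
    qed
  qed
  then show ?thesis
    by (subst AE_restrict_space_iff) auto
qed

lemma walsh_xor:
  assumes "\<forall>i. sin (2 ^ (i + 1) * pi * t) \<noteq> 0"
  shows "walsh (m XOR n) t = walsh m t * walsh n t"
proof -
  have "walsh n t = bit_product (\<lambda>i. complex_of_real (rademacher i t)) n" for n
    by (simp add: walsh_def bit_product_def)
  moreover have "complex_of_real (rademacher i t) * complex_of_real (rademacher i t) = 1" for i
    using assms by (simp add: rademacher_def sgn_if)
  ultimately show ?thesis
    using bit_product_xor by metis
qed

context
  fixes \<sigma> :: "nat \<Rightarrow> nat" and t :: real
  assumes \<sigma>: "dyadically_linear \<sigma>" and t: "\<forall>i. sin (2 ^ (i + 1) * pi * t) \<noteq> 0"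
begin

text \<open>
  Since \<open>\<sigma>\<close> is linear, \<open>k \<mapsto> walsh (\<sigma> k) t\<close> is itself a character, and so is its product with
  \<open>dyadic_char j\<close>.
\<close>

lemma character_mean_walsh_0_1:
  "character_mean n (\<lambda>k. walsh (\<sigma> k)) j t \<in> {0, 1}"
proof -
  have "(\<Sum>k<2 ^ n. dyadic_char j k * walsh (\<sigma> k) t) = 0 \<or>
      (\<Sum>k<2 ^ n. dyadic_char j k * walsh (\<sigma> k) t) = 2 ^ n"
    using \<sigma> t
    by (intro character_sum_dichotomy) (simp add: dyadically_linear_def dyadic_char_xor walsh_xor)
  moreover have "character_mean n (\<lambda>k. walsh (\<sigma> k)) j t =
      (\<Sum>k<2 ^ n. dyadic_char j k * walsh (\<sigma> k) t) / 2 ^ n"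
    by (simp add: character_mean_def sum_divide_distrib)
  ultimately show ?thesis
    by auto
qed

text \<open>
  The means take only the values 0 and 1 and add up to \<open>walsh 0 t = 1\<close>, so exactly one of them is 1.
\<close>

lemma sum_norm_character_mean_walsh:
  "(\<Sum>j<2 ^ n. norm (character_mean n (\<lambda>k. walsh (\<sigma> k)) j t) powr p) = 1"
proof -
  let ?V = "\<lambda>j. character_mean n (\<lambda>k. walsh (\<sigma> k)) j t"
  have "\<sigma> 0 = 0"
    using \<sigma> unfolding dyadically_linear_def by (metis xor_self_eq)
  then have "(\<Sum>j<2 ^ n. ?V j) = 1"
    by (simp add: sum_character_mean walsh_def)
  moreover have "complex_of_real (norm (?V j) powr p) = ?V j" for j
    using character_mean_walsh_0_1 [of n j] by auto
  then have "complex_of_real (\<Sum>j<2 ^ n. norm (?V j) powr p) = (\<Sum>j<2 ^ n. ?V j)"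
    by simp
  ultimately show ?thesis
    by (metis of_real_eq_1_iff)
qed

end

section \<open>Moments of the trigonometric character means\<close>

lemma integrable_unit_interval:
  fixes f :: "real \<Rightarrow> 'b::{banach,second_countable_topology}"
  assumes "f \<in> borel_measurable (lebesgue_on {0..1})" "\<And>t. norm (f t) \<le> B"
  shows "integrable (lebesgue_on {0..1}) f"
proof -
  interpret finite_measure "lebesgue_on {0..1::real}"
    by (rule finite_measure_lebesgue_on) auto
  show ?thesis
    by (rule integrable_const_bound [of _ B]) (use assms in auto)
qed

lemma norm_character_mean_le_1:
  assumes "\<And>k. norm (a k t) \<le> 1"
  shows "norm (character_mean n a j t) \<le> 1"
proof -
  have "norm (character_mean n a j t) \<le> (\<Sum>k\<in>{..<2 ^ n :: nat}. 1 / 2 ^ n)"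
    unfolding character_mean_def
    by (rule sum_norm_le) (simp add: norm_mult norm_divide norm_power divide_right_mono assms)
  then show ?thesis
    by simp
qed

lemma integrable_character_mean_powr:
  assumes meas: "\<And>k. a k \<in> borel_measurable (lebesgue_on {0..1})"
    and bound: "\<And>k t. norm (a k t) \<le> 1" and "0 \<le> p"
  shows "integrable (lebesgue_on {0..1}) (\<lambda>t. norm (character_mean n a j t) powr p)"
proof -
  have "character_mean n a j \<in> borel_measurable (lebesgue_on {0..1})"
    unfolding character_mean_def [abs_def] using meas by measurable
  then have "(\<lambda>t. norm (character_mean n a j t) powr p) \<in> borel_measurable (lebesgue_on {0..1})"
    by measurable
  then show ?thesis
    by (rule integrable_unit_interval [of _ 1])
       (use norm_character_mean_le_1 [OF bound] \<open>0 \<le> p\<close> in \<open>simp add: powr_le1\<close>)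
qed

lemma trig_add: "trig (a + b) t = trig a t * trig b t"
  by (simp add: trig_def algebra_simps exp_add)

lemma integrable_trig_mult_cnj:
  "integrable (lebesgue_on {0..1}) (\<lambda>t. trig a t * cnj (trig b t))"
proof (rule integrable_unit_interval [of _ 1])
  have "continuous_on {0..1} (\<lambda>t. trig a t * cnj (trig b t))"
    unfolding trig_def by (intro continuous_intros)
  then show "(\<lambda>t. trig a t * cnj (trig b t)) \<in> borel_measurable (lebesgue_on {0..1})"
    by (rule continuous_imp_measurable_on_sets_lebesgue) simp
qed (simp add: norm_mult norm_trig)

text \<open>
  The product is \<open>exp (w * t)\<close> with \<open>w\<close> an integer multiple of \<open>2 \<pi> i\<close>; for \<open>w \<noteq> 0\<close> its primitive
  \<open>exp (w * t) / w\<close> has the same value at both endpoints.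
\<close>

lemma trig_orthonormal:
  "(LINT t|lebesgue_on {0..1}. trig a t * cnj (trig b t)) = (if a = b then 1 else 0)"
proof (cases "a = b")
  case True
  have "trig b t * cnj (trig b t) = 1" for t
    by (simp add: complex_norm_square [symmetric] norm_trig)
  then show ?thesis
    using True by (simp add: measure_restrict_space)
next
  case False
  define w :: complex where "w = 2 * of_real pi * \<i> * (of_nat a - of_nat b)"
  have "w \<noteq> 0"
    using False by (simp add: w_def)
  have "exp w = 1"
    using exp_integer_2pi [of "of_int (int a - int b)"] by (simp add: w_def algebra_simps)
  have eq: "trig a t * cnj (trig b t) = exp (w * of_real t)" for t
    by (simp add: trig_def w_def exp_cnj exp_add [symmetric] algebra_simps)
  have "((\<lambda>t. exp (w * of_real t)) has_integral
      exp (w * of_real 1) / w - exp (w * of_real 0) / w) {0..1}"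
  proof (rule fundamental_theorem_of_calculus)
    fix x :: real
    have "((\<lambda>z. exp (w * z) / w) has_field_derivative exp (w * of_real x)) (at (of_real x))"
      using \<open>w \<noteq> 0\<close> by (auto intro!: derivative_eq_intros)
    then show "((\<lambda>t. exp (w * of_real t) / w) has_vector_derivative exp (w * of_real x))
        (at x within {0..1})"
      by (rule has_vector_derivative_real_field)
  qed simp
  then have "integral {0..1} (\<lambda>t. trig a t * cnj (trig b t)) = 0"
    using \<open>exp w = 1\<close> by (simp add: eq integral_unique)
  then show ?thesis
    using False lebesgue_integral_eq_integral [OF integrable_trig_mult_cnj, of a b] by simp
qed

text \<open>
  Frequencies \<open>f i\<close> may repeat: for the fourth moment, the square of a sum is again such a sum,
  indexed by pairs \<open>(k, l)\<close> with frequency \<open>k + l\<close>.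
\<close>

lemma integral_norm_trig_sum_square:
  fixes c :: "'i \<Rightarrow> complex"
  shows "complex_of_real (LINT t|lebesgue_on {0..1}. (norm (\<Sum>i\<in>I. c i * trig (f i) t))\<^sup>2) =
    (\<Sum>i\<in>I. \<Sum>j\<in>I. if f i = f j then c i * cnj (c j) else 0)"
proof -
  have "complex_of_real ((norm (\<Sum>i\<in>I. c i * trig (f i) t))\<^sup>2) =
      (\<Sum>i\<in>I. \<Sum>j\<in>I. (c i * cnj (c j)) * (trig (f i) t * cnj (trig (f j) t)))" for t
    by (simp add: complex_norm_square sum_product ac_simps del: of_real_power)
  then have "complex_of_real (LINT t|lebesgue_on {0..1}. (norm (\<Sum>i\<in>I. c i * trig (f i) t))\<^sup>2) =
      (LINT t|lebesgue_on {0..1}.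
        (\<Sum>i\<in>I. \<Sum>j\<in>I. (c i * cnj (c j)) * (trig (f i) t * cnj (trig (f j) t))))"
    by (simp add: integral_complex_of_real [symmetric] del: of_real_power)
  also have "\<dots> = (\<Sum>i\<in>I. \<Sum>j\<in>I. (c i * cnj (c j)) * (if f i = f j then 1 else 0))"
    by (simp add: integrable_trig_mult_cnj trig_orthonormal)
  also have "\<dots> = (\<Sum>i\<in>I. \<Sum>j\<in>I. if f i = f j then c i * cnj (c j) else 0)"
    by (intro sum.cong) auto
  finally show ?thesis .
qed

lemma second_moment:
  "(\<Sum>j<2 ^ n. LINT t|lebesgue_on {0..1}. (norm (character_mean n trig j t))\<^sup>2) = 1"
proof -
  have "complex_of_real (LINT t|lebesgue_on {0..1}. (norm (character_mean n trig j t))\<^sup>2) = 1 / 2 ^ n" for j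
    unfolding character_mean_def integral_norm_trig_sum_square [of _ "\<lambda>k. k"]
    by (simp add: dyadic_char_square power2_eq_square)
  then have "complex_of_real (\<Sum>j<2 ^ n. LINT t|lebesgue_on {0..1}. (norm (character_mean n trig j t))\<^sup>2) = 1"
    by simp
  then show ?thesis
    by (metis of_real_eq_1_iff)
qed

text \<open>
  Expanding gives \<open>2 ^ (-4 * n)\<close> times a sum over quadruples \<open>(k, l, m, q)\<close>. Integration keeps those
  with \<open>k + l = m + q\<close>, summation over the characters keeps those with \<open>k XOR l = m XOR q\<close> and
  gives a factor \<open>2 ^ n\<close>. Hence the value is the number of elements of \<open>A_set id n\<close> over
  \<open>(2 ^ n) ^ 3\<close>, and \<open>6 / 8 < 1\<close> is what separates the two systems.
\<close>

lemma fourth_moment: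
  "(\<Sum>j<2 ^ n. LINT t|lebesgue_on {0..1}. norm (character_mean n trig j t) ^ 4) \<le> (3 / 4) ^ n"
proof -
  define I :: "(nat \<times> nat) set" where "I = {..<2 ^ n} \<times> {..<2 ^ n}"
  define c where "c = (\<lambda>j (k, l). dyadic_char j k * dyadic_char j l / (2 ^ n * 2 ^ n))"
  define s where "s = (\<lambda>(k::nat, l). k + l)"
  define x where "x = (\<lambda>(k::nat, l). k XOR l)"
  define B where "B = {(u, v) \<in> I \<times> I. s u = s v \<and> x u = x v}"
  have "finite I"
    by (simp add: I_def)
  have square: "(character_mean n trig j t)\<^sup>2 = (\<Sum>u\<in>I. c j u * trig (s u) t)" for j t
    unfolding character_mean_def power2_eq_square sum_product I_def c_def s_def
    by (simp add: sum.cartesian_product trig_add field_simps split_def)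
  have orth: "(\<Sum>j<2 ^ n. c j u * cnj (c j v)) = (if x u = x v then 1 / (2 ^ n) ^ 3 else 0)"
    if "u \<in> I" "v \<in> I" for u v
  proof -
    have "c j u * cnj (c j v) = dyadic_char j (x u) * dyadic_char j (x v) / (2 ^ n) ^ 4" for j
      by (simp add: c_def x_def dyadic_char_xor split_def power4_eq_xxxx)
    then have "(\<Sum>j<2 ^ n. c j u * cnj (c j v)) =
        (\<Sum>j<2 ^ n. dyadic_char j (x u) * dyadic_char j (x v)) / (2 ^ n) ^ 4"
      by (simp add: sum_divide_distrib)
    also have "(\<Sum>j<2 ^ n. dyadic_char j (x u) * dyadic_char j (x v)) = (if x u = x v then 2 ^ n else 0)"
      by (rule dyadic_char_orthogonal)
         (use that in \<open>auto simp: x_def I_def xor_less_power_of_two\<close>)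
    finally show ?thesis
      by (simp add: eval_nat_numeral)
  qed
  have "norm (character_mean n trig j t) ^ 4 = (norm (\<Sum>u\<in>I. c j u * trig (s u) t))\<^sup>2" for j t
    by (simp add: square [symmetric] norm_power)
  then have "complex_of_real (\<Sum>j<2 ^ n. LINT t|lebesgue_on {0..1}. norm (character_mean n trig j t) ^ 4) =
      (\<Sum>j<2 ^ n. \<Sum>u\<in>I. \<Sum>v\<in>I. if s u = s v then c j u * cnj (c j v) else 0)"
    by (simp add: integral_norm_trig_sum_square)
  also have "\<dots> = (\<Sum>u\<in>I. \<Sum>v\<in>I. \<Sum>j<2 ^ n. if s u = s v then c j u * cnj (c j v) else 0)"
    by (subst sum.swap, rule sum.cong [OF refl], rule sum.swap)
  also have "\<dots> = (\<Sum>u\<in>I. \<Sum>v\<in>I. if s u = s v \<and> x u = x v then 1 / (2 ^ n) ^ 3 else 0)"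
    proof (intro sum.cong refl)
    fix u v assume "u \<in> I" "v \<in> I"
    then show "(\<Sum>j<2 ^ n. if s u = s v then c j u * cnj (c j v) else 0) =
        (if s u = s v \<and> x u = x v then 1 / (2 ^ n) ^ 3 else 0)"
      by (cases "s u = s v") (simp_all add: orth)
  qed
  also have "\<dots> = (\<Sum>w\<in>I \<times> I. if w \<in> B then 1 / (2 ^ n) ^ 3 else 0)"
    unfolding sum.cartesian_product by (rule sum.cong) (simp_all add: B_def split_def mem_Times_iff)
  also have "\<dots> = (\<Sum>w\<in>(I \<times> I) \<inter> B. 1 / (2 ^ n) ^ 3)"
    by (rule sum.inter_restrict [symmetric]) (simp add: \<open>finite I\<close>)
  also have "(I \<times> I) \<inter> B = B"
    by (auto simp: B_def)
  also have "(\<Sum>w\<in>B. 1 / (2 ^ n) ^ 3) = complex_of_real (card B / (2 ^ n) ^ 3)"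
    by simp
  finally have eq: "(\<Sum>j<2 ^ n. LINT t|lebesgue_on {0..1}. norm (character_mean n trig j t) ^ 4) =
      card B / (2 ^ n) ^ 3"
    unfolding of_real_eq_iff .
  define h where "h = (\<lambda>((k::nat, l::nat), (m::nat, q::nat)). (k, l, m))"
  have "inj_on h B"
    by (auto simp: h_def B_def inj_on_def s_def)
  moreover have "h ` B \<subseteq> A_set id n"
  proof clarify
    fix k l m k' l' m' q'
    assume "((k', l'), (m', q')) \<in> B" and eq: "(k, l, m) = h ((k', l'), (m', q'))"
    then have "q' < 2 ^ n \<and> k < 2 ^ n \<and> l < 2 ^ n \<and> m < 2 ^ n \<and> k + l = m + q' \<and> k XOR l = m XOR q'"
      by (simp add: B_def I_def s_def x_def h_def)
    then show "(k, l, m) \<in> A_set id n"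
      unfolding A_set_id_iff by blast
  qed
  ultimately have "card B \<le> card (A_set id n)"
    using finite_A_set by (rule card_inj_on_le)
  also have "\<dots> \<le> 6 ^ n"
    by (rule card_A_set_id)
  finally have "real (card B) \<le> 6 ^ n"
    by (metis of_nat_le_iff of_nat_numeral of_nat_power)
  then have "card B / (2 ^ n) ^ 3 \<le> 6 ^ n / ((2::real) ^ n) ^ 3"
    by (rule divide_right_mono) simp
  also have "\<dots> = (6 / 2 ^ 3) ^ n"
    by (simp only: power_divide power_mult [symmetric] mult.commute)
  finally show ?thesis
    unfolding eq by simp
qed

section \<open>Consequences of equivalence\<close>

lemma Lp_norm_infinity_le:
  assumes "f \<in> borel_measurable (lebesgue_on {0..1})" "0 \<le> C"
    and "AE t in lebesgue_on {0..1}. norm (f t) \<le> C"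
  shows "Lp_norm \<infinity> f \<le> C"
proof -
  have "esssup (lebesgue_on {0..1}) (\<lambda>t. ereal (norm (f t))) \<le> ereal C"
    using assms by (intro esssup_I) auto
  then show ?thesis
    using \<open>0 \<le> C\<close> unfolding Lp_norm_def
    by (cases "esssup (lebesgue_on {0..1}) (\<lambda>t. ereal (norm (f t)))") auto
qed

text \<open>
  The essential supremum bounds a continuous function at every interior point, because a nonempty
  open set is not null.
\<close>

lemma norm_le_Lp_norm_infinity:
  assumes f: "continuous_on {0..1} f" and s: "s \<in> {0<..<1}"
  shows "norm (f s) \<le> Lp_norm \<infinity> f"
proof -
  let ?M = "lebesgue_on {0..1::real}"
  define E where "E = esssup ?M (\<lambda>t. ereal (norm (f t)))"
  have meas: "f \<in> borel_measurable ?M"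
    using f by (rule continuous_imp_measurable_on_sets_lebesgue) simp
  have "compact (f ` {0..1})"
    using f by (intro compact_continuous_image) auto
  then obtain B where B: "\<And>t. t \<in> {0..1} \<Longrightarrow> norm (f t) \<le> B"
    using compact_imp_bounded bounded_iff by (metis imageI)
  have "E \<le> ereal B"
    unfolding E_def using meas B by (intro esssup_I) (auto intro!: AE_I2)
  then have "E \<noteq> \<infinity>"
    by auto
  have "AE t in ?M. ereal (norm (f t)) \<le> E"
    unfolding E_def by (rule esssup_AE)
  then have "AE t in ?M. norm (f t) \<le> real_of_ereal E"
  proof (rule eventually_mono)
    fix t assume "ereal (norm (f t)) \<le> E"
    then show "norm (f t) \<le> real_of_ereal E"
      using \<open>E \<noteq> \<infinity>\<close> by (cases E) auto
  qed
  then have AE: "AE t in lebesgue. t \<in> {0..1} \<longrightarrow> norm (f t) \<le> real_of_ereal E"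
    by (subst (asm) AE_restrict_space_iff) auto
  let ?C = "{t \<in> {0..1}. norm (f t) \<le> real_of_ereal E}"
  have "closed ?C"
    using f by (intro continuous_on_closed_Collect_le continuous_intros) auto
  moreover from AE have "AE t in lebesgue. t \<in> {0<..<1} \<longrightarrow> t \<in> ?C"
    by (rule eventually_mono) auto
  ultimately have "s \<in> ?C"
    using s by (intro mem_closed_if_AE_lebesgue_open [of "{0<..<1}" ?C]) auto
  then show ?thesis
    by (simp add: Lp_norm_def E_def)
qed

lemma Lp_equivalent_sym:
  assumes "Lp_equivalent p a b"
  shows "Lp_equivalent p b a"
  using assms unfolding Lp_equivalent_def by (auto simp: field_simps)

text \<open>
  Equivalence for sums over initial segments, where the coefficients may vanish.
\<close>

lemma Lp_equivalentE:
  assumes "Lp_equivalent p a b"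
  obtains c where "c > 0"
    "\<And>N x. Lp_norm p (\<lambda>t. \<Sum>k<N. x k * a k t) \<le> c * Lp_norm p (\<lambda>t. \<Sum>k<N. x k * b k t)"
    "\<And>N x. Lp_norm p (\<lambda>t. \<Sum>k<N. x k * b k t) \<le> c * Lp_norm p (\<lambda>t. \<Sum>k<N. x k * a k t)"
proof -
  from assms obtain c where c: "c > 0"
    and *: "\<And>\<xi>. finite {k. \<xi> k \<noteq> 0} \<Longrightarrow>
      (1 / c) * Lp_norm p (\<lambda>t. \<Sum>k | \<xi> k \<noteq> 0. \<xi> k * a k t)
        \<le> Lp_norm p (\<lambda>t. \<Sum>k | \<xi> k \<noteq> 0. \<xi> k * b k t) \<and>
      Lp_norm p (\<lambda>t. \<Sum>k | \<xi> k \<noteq> 0. \<xi> k * b k t)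
        \<le> c * Lp_norm p (\<lambda>t. \<Sum>k | \<xi> k \<noteq> 0. \<xi> k * a k t)"
    unfolding Lp_equivalent_def by blast
  show ?thesis
  proof (rule that [OF c])
    fix N :: nat and x :: "nat \<Rightarrow> complex"
    define \<xi> where "\<xi> k = (if k < N then x k else 0)" for k
    have fin: "finite {k. \<xi> k \<noteq> 0}"
      by (rule finite_subset [of _ "{..<N}"]) (auto simp: \<xi>_def split: if_splits)
    have "(\<Sum>k | \<xi> k \<noteq> 0. \<xi> k * u k) = (\<Sum>k<N. x k * u k)" for u
      by (rule sum.mono_neutral_cong_left) (auto simp: \<xi>_def split: if_splits)
    with * [OF fin] c
    show "Lp_norm p (\<lambda>t. \<Sum>k<N. x k * a k t) \<le> c * Lp_norm p (\<lambda>t. \<Sum>k<N. x k * b k t)"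
      "Lp_norm p (\<lambda>t. \<Sum>k<N. x k * b k t) \<le> c * Lp_norm p (\<lambda>t. \<Sum>k<N. x k * a k t)"
      by (simp_all add: field_simps)
  qed
qed

lemma integral_powr_le_of_Lp_norm_le:
  assumes "Lp_norm (ereal r) f \<le> c * Lp_norm (ereal r) g" "0 < r" "0 \<le> c"
  shows "(LINT t|lebesgue_on {0..1}. norm (f t) powr r)
    \<le> c powr r * (LINT t|lebesgue_on {0..1}. norm (g t) powr r)"
proof -
  define F where "F = (LINT t|lebesgue_on {0..1}. norm (f t) powr r)"
  define G where "G = (LINT t|lebesgue_on {0..1}. norm (g t) powr r)"
  have nonneg: "0 \<le> F" "0 \<le> G"
    by (simp_all add: F_def G_def)
  have "F powr (1 / r) \<le> c * G powr (1 / r)"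
    using assms(1) by (simp add: Lp_norm_def F_def G_def)
  then have "(F powr (1 / r)) powr r \<le> (c * G powr (1 / r)) powr r"
    using \<open>0 < r\<close> by (intro powr_mono2) auto
  then have "F \<le> c powr r * G"
    using \<open>0 < r\<close> \<open>0 \<le> c\<close> nonneg by (simp add: powr_mult powr_powr)
  then show ?thesis
    by (simp add: F_def G_def)
qed

definition trig_moment :: "real \<Rightarrow> nat \<Rightarrow> real"
  where "trig_moment r n =
    (\<Sum>j<2 ^ n. LINT t|lebesgue_on {0..1}. norm (character_mean n trig j t) powr r)"

lemma integrable_trig_mean:
  "0 \<le> r \<Longrightarrow> integrable (lebesgue_on {0..1}) (\<lambda>t. norm (character_mean n trig j t) powr r)"
  by (rule integrable_character_mean_powr) (simp_all add: measurable_trig norm_trig)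

lemma norm_trig_mean_le_1: "norm (character_mean n trig j t) \<le> 1"
  by (rule norm_character_mean_le_1) (simp add: norm_trig)

lemma walsh_moment:
  assumes "dyadically_linear \<sigma>" "0 \<le> r"
  shows "(\<Sum>j<2 ^ n. LINT t|lebesgue_on {0..1}.
    norm (character_mean n (\<lambda>k. walsh (\<sigma> k)) j t) powr r) = 1"
proof -
  let ?V = "\<lambda>j t. norm (character_mean n (\<lambda>k. walsh (\<sigma> k)) j t) powr r"
  have int: "integrable (lebesgue_on {0..1}) (?V j)" for j
    by (rule integrable_character_mean_powr)
       (simp_all add: measurable_walsh norm_walsh_le_1 assms)
  have "(\<Sum>j<2 ^ n. LINT t|lebesgue_on {0..1}. ?V j t) = (LINT t|lebesgue_on {0..1}. (\<Sum>j<2 ^ n. ?V j t))"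
    by (simp add: int)
  also have "\<dots> = (LINT t|lebesgue_on {0..1::real}. 1)"
  proof (rule integral_cong_AE)
    show "AE t in lebesgue_on {0..1}. (\<Sum>j<2 ^ n. ?V j t) = 1"
      using AE_sin_nonzero by (rule eventually_mono) (rule sum_norm_character_mean_walsh [OF assms(1)])
    show "(\<lambda>t. \<Sum>j<2 ^ n. ?V j t) \<in> borel_measurable (lebesgue_on {0..1})"
      using int by (intro borel_measurable_sum) (rule borel_measurable_integrable)
  qed simp
  also have "\<dots> = 1"
    by (simp add: measure_restrict_space)
  finally show ?thesis .
qed

text \<open>
  Equivalence is applied to each character mean and then summed over the characters: the Walsh side
  becomes 1 by \<open>walsh_moment\<close>.
\<close>

lemma trig_moment_bounds_of_equivalent:
  assumes \<sigma>: "dyadically_linear \<sigma>" and "0 < r"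
    and equiv: "Lp_equivalent (ereal r) trig (\<lambda>k. walsh (\<sigma> k))"
  obtains C where "C > 0" "\<And>n. trig_moment r n \<le> C" "\<And>n. 1 \<le> C * trig_moment r n"
proof -
  from equiv obtain c where "c > 0"
    and upper: "\<And>N x. Lp_norm (ereal r) (\<lambda>t. \<Sum>k<N. x k * trig k t)
      \<le> c * Lp_norm (ereal r) (\<lambda>t. \<Sum>k<N. x k * walsh (\<sigma> k) t)"
    and lower: "\<And>N x. Lp_norm (ereal r) (\<lambda>t. \<Sum>k<N. x k * walsh (\<sigma> k) t)
      \<le> c * Lp_norm (ereal r) (\<lambda>t. \<Sum>k<N. x k * trig k t)"
    by (rule Lp_equivalentE) blast
  let ?W = "\<lambda>n j t. norm (character_mean n (\<lambda>k. walsh (\<sigma> k)) j t) powr r"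
  let ?T = "\<lambda>n j t. norm (character_mean n trig j t) powr r"
  have T: "(LINT t|lebesgue_on {0..1}. ?T n j t) \<le> c powr r * (LINT t|lebesgue_on {0..1}. ?W n j t)" for n j
    unfolding character_mean_def
    by (rule integral_powr_le_of_Lp_norm_le [OF upper]) (use \<open>c > 0\<close> \<open>0 < r\<close> in auto)
  have W: "(LINT t|lebesgue_on {0..1}. ?W n j t) \<le> c powr r * (LINT t|lebesgue_on {0..1}. ?T n j t)" for n j
    unfolding character_mean_def
    by (rule integral_powr_le_of_Lp_norm_le [OF lower]) (use \<open>c > 0\<close> \<open>0 < r\<close> in auto)
  show ?thesis
  proof
    show "c powr r > 0"
      using \<open>c > 0\<close> by simp
    fix n
    have W1: "(\<Sum>j<2 ^ n. LINT t|lebesgue_on {0..1}. ?W n j t) = 1"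
      using \<sigma> \<open>0 < r\<close> by (intro walsh_moment) auto
    have "trig_moment r n \<le> (\<Sum>j<2 ^ n. c powr r * (LINT t|lebesgue_on {0..1}. ?W n j t))"
      unfolding trig_moment_def by (intro sum_mono T)
    then show "trig_moment r n \<le> c powr r"
      by (simp only: sum_distrib_left [symmetric] W1)
    have "(\<Sum>j<2 ^ n. LINT t|lebesgue_on {0..1}. ?W n j t) \<le>
        (\<Sum>j<2 ^ n. c powr r * (LINT t|lebesgue_on {0..1}. ?T n j t))"
      by (intro sum_mono W)
    then show "1 \<le> c powr r * trig_moment r n"
      by (simp only: sum_distrib_left [symmetric] W1 trig_moment_def)
  qed
qed

lemma character_mean_combination:
  "(\<Sum>j<2 ^ n. h j * character_mean n a j t) =
    (\<Sum>k<2 ^ n. (\<Sum>j<2 ^ n. h j * (dyadic_char j k / 2 ^ n)) * a k t)"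
  unfolding character_mean_def sum_distrib_left sum_distrib_right
  by (subst sum.swap) (simp add: mult.assoc)

text \<open>
  At \<open>p = \<infinity>\<close> the individual Walsh means have norm at most 1, but so has every combination of them
  with coefficients \<open>h j\<close> of modulus at most 1, as they form a partition of unity. The
  corresponding combination of trigonometric means is therefore bounded by \<open>c\<close> at each \<open>s\<close>. With
  \<open>h j\<close> the conjugate phases at \<open>s\<close>, its value there is the sum of the moduli of the means.
\<close>

lemma trig_moment_1_bound_of_equivalent_infinity:
  assumes \<sigma>: "dyadically_linear \<sigma>"
    and equiv: "Lp_equivalent \<infinity> trig (\<lambda>k. walsh (\<sigma> k))"
  obtains C where "\<And>n. trig_moment 1 n \<le> C"
proof -
  from equiv obtain c where "c > 0"
    and upper: "\<And>N x. Lp_norm \<infinity> (\<lambda>t. \<Sum>k<N. x k * trig k t)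
      \<le> c * Lp_norm \<infinity> (\<lambda>t. \<Sum>k<N. x k * walsh (\<sigma> k) t)"
    by (rule Lp_equivalentE) blast
  have bound: "(\<Sum>j<2 ^ n. norm (character_mean n trig j s)) \<le> c" if s: "s \<in> {0<..<1}" for n s
  proof -
    define h where "h j = cnj (sgn (character_mean n trig j s))" for j
    have h1: "norm (h j) \<le> 1" for j
      by (simp add: h_def norm_sgn)
    have h2: "h j * character_mean n trig j s = norm (character_mean n trig j s)" for j
      by (simp add: h_def sgn_eq complex_norm_square [symmetric] power2_eq_square mult.commute)
    let ?f = "\<lambda>t. \<Sum>j<2 ^ n. h j * character_mean n trig j t"
    let ?g = "\<lambda>t. \<Sum>j<2 ^ n. h j * character_mean n (\<lambda>k. walsh (\<sigma> k)) j t"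
    have g_meas: "?g \<in> borel_measurable (lebesgue_on {0..1})"
      unfolding character_mean_def using measurable_walsh by measurable
    have "AE t in lebesgue_on {0..1}. norm (?g t) \<le> 1"
      using AE_sin_nonzero
    proof (rule eventually_mono)
      fix t assume t: "\<forall>i. sin (2 ^ (i + 1) * pi * t) \<noteq> 0"
      have "norm (?g t) \<le> (\<Sum>j<2 ^ n. norm (character_mean n (\<lambda>k. walsh (\<sigma> k)) j t) powr 1)"
        by (rule sum_norm_le) (simp add: norm_mult mult_left_le_one_le h1)
      then show "norm (?g t) \<le> 1"
        using sum_norm_character_mean_walsh [OF \<sigma> t, of n 1] by simp
    qed
    then have g: "Lp_norm \<infinity> ?g \<le> 1"
      using g_meas by (intro Lp_norm_infinity_le) auto
    have f_cont: "continuous_on {0..1} ?f"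
      unfolding character_mean_def trig_def by (intro continuous_intros)
    have "(\<Sum>j<2 ^ n. norm (character_mean n trig j s)) = norm (?f s)"
      unfolding h2 by (simp add: sum_nonneg flip: of_real_sum)
    also have "\<dots> \<le> Lp_norm \<infinity> ?f"
      by (rule norm_le_Lp_norm_infinity [OF f_cont s])
    also have "\<dots> \<le> c * Lp_norm \<infinity> ?g"
      unfolding character_mean_combination by (rule upper)
    also have "\<dots> \<le> c"
      using g \<open>c > 0\<close> by simp
    finally show ?thesis .
  qed
  have "trig_moment 1 n \<le> c" for n
  proof -
    have int: "integrable (lebesgue_on {0..1}) (\<lambda>t. norm (character_mean n trig j t))" for j
      using integrable_trig_mean [of 1 n j] by simp
    have "trig_moment 1 n =
        (LINT t|lebesgue_on {0..1}. (\<Sum>j<2 ^ n. norm (character_mean n trig j t)))"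
      by (simp add: trig_moment_def int)
    also have "\<dots> \<le> (LINT t|lebesgue_on {0..1::real}. c)"
    proof (rule integral_mono_AE)
      have "{0, 1::real} \<in> null_sets lebesgue"
        by (rule null_sets_completionI [OF finite_imp_null_set_lborel]) simp
      then have "AE t in lebesgue. t \<notin> {0, 1::real}"
        by (rule AE_not_in)
      then have "AE t in lebesgue. t \<in> {0..1} \<longrightarrow> (\<Sum>j<2 ^ n. norm (character_mean n trig j t)) \<le> c"
        by (rule eventually_mono) (use bound in auto)
      then show "AE t in lebesgue_on {0..1}. (\<Sum>j<2 ^ n. norm (character_mean n trig j t)) \<le> c"
        by (subst AE_restrict_space_iff) auto
    qed (use int in auto)
    also have "\<dots> = c"
      by (simp add: measure_restrict_space)
    finally show ?thesis .
  qed
  then show ?thesis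
    by (rule that)
qed

section \<open>Growth of the moments\<close>

lemma trig_moment_2: "trig_moment 2 n = 1"
  using second_moment [of n] by (simp add: trig_moment_def)

lemma trig_moment_4: "trig_moment 4 n \<le> (3 / 4) ^ n"
  using fourth_moment [of n] by (simp add: trig_moment_def)

text \<open>
  Pointwise inequalities between powers on \<open>{0..1}\<close> are inherited by the moments, since the means are
  bounded by 1. This replaces Hoelder's inequality.
\<close>

lemma trig_moment_interpolate:
  assumes le: "\<And>y. 0 \<le> y \<Longrightarrow> y \<le> 1 \<Longrightarrow> y powr r \<le> A * y powr q + B * y powr s"
    and "0 \<le> q" "0 \<le> r" "0 \<le> s"
  shows "trig_moment r n \<le> A * trig_moment q n + B * trig_moment s n"
proof -
  let ?T = "\<lambda>p j t. norm (character_mean n trig j t) powr p"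
  have "trig_moment r n \<le>
      (\<Sum>j<2 ^ n. LINT t|lebesgue_on {0..1}. A * ?T q j t + B * ?T s j t)"
    unfolding trig_moment_def
    by (intro sum_mono integral_mono le Bochner_Integration.integrable_add integrable_mult_right
          integrable_trig_mean assms norm_trig_mean_le_1 norm_ge_zero)
  also have "\<dots> = A * trig_moment q n + B * trig_moment s n"
    using assms(2,4)
    by (simp add: trig_moment_def integrable_trig_mean sum.distrib sum_distrib_left)
  finally show ?thesis .
qed

text \<open>
  The first summand alone suffices for \<open>y \<le> \<mu>\<close>, the second for \<open>y > \<mu>\<close>.
\<close>

lemma interpolate_second:
  fixes y \<mu> r :: real
  assumes "0 \<le> y" "0 < \<mu>" "r < 2"
  shows "y powr 2 \<le> \<mu> powr (2 - r) * y powr r + \<mu> powr - 2 * y powr 4"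
proof (cases "y \<le> \<mu>")
  case True
  have "y powr 2 = y powr (2 - r) * y powr r"
    by (simp add: powr_add [symmetric])
  also have "\<dots> \<le> \<mu> powr (2 - r) * y powr r"
    using assms True by (intro mult_right_mono powr_mono2) auto
  finally show ?thesis
    by (simp add: add_increasing2)
next
  case False
  have "y powr 2 = y powr - 2 * y powr 4"
    by (simp add: powr_add [symmetric])
  also have "\<dots> \<le> \<mu> powr - 2 * y powr 4"
    using assms False by (intro mult_right_mono powr_mono2') auto
  finally show ?thesis
    by (simp add: add_increasing)
qed

text \<open>
  Again the two summands serve \<open>y \<le> \<mu>\<close> and \<open>y > \<mu>\<close>. In the latter case it is enough to compare
  \<open>y powr r \<le> 1\<close> with \<open>(y / \<mu>) powr 4\<close>, which works for all \<open>r\<close> at once.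
\<close>

lemma interpolate_high:
  fixes y \<mu> r :: real
  assumes "0 \<le> y" "y \<le> 1" "0 < \<mu>" "2 < r"
  shows "y powr r \<le> \<mu> powr (r - 2) * y powr 2 + \<mu> powr - 4 * y powr 4"
proof (cases "y \<le> \<mu>")
  case True
  have "y powr r = y powr (r - 2) * y powr 2"
    by (simp add: powr_add [symmetric])
  also have "\<dots> \<le> \<mu> powr (r - 2) * y powr 2"
    using assms True by (intro mult_right_mono powr_mono2) auto
  finally show ?thesis
    by (simp add: add_increasing2)
next
  case False
  have "y powr r \<le> 1"
    using assms by (simp add: powr_le1)
  also have "1 = y powr - 4 * y powr 4"
    using False assms by (simp only: powr_add [symmetric]) simp
  also have "\<dots> \<le> \<mu> powr - 4 * y powr 4"
    using assms False by (intro mult_right_mono powr_mono2') auto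
  finally show ?thesis
    by (simp add: add_increasing)
qed

text \<open>
  Let \<open>n\<close> tend to infinity with \<open>\<mu>\<close> fixed, then \<open>\<mu>\<close> to 0.
\<close>

lemma no_vanishing_bound:
  fixes C d a :: real
  assumes "d > 0" "a > 0"
    and le: "\<And>\<mu> n. \<mu> > 0 \<Longrightarrow> d \<le> C * \<mu> powr a + D \<mu> * (3 / 4) ^ n"
  shows False
proof -
  have *: "d \<le> C * \<mu> powr a" if "\<mu> > 0" for \<mu>
  proof (rule LIMSEQ_le_const)
    have "(\<lambda>n. C * \<mu> powr a + D \<mu> * (3 / 4) ^ n) \<longlonglongrightarrow> C * \<mu> powr a + D \<mu> * 0"
      by (intro tendsto_intros LIMSEQ_power_zero) simp
    then show "(\<lambda>n. C * \<mu> powr a + D \<mu> * (3 / 4) ^ n) \<longlonglongrightarrow> C * \<mu> powr a"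
      by simp
    show "\<exists>N. \<forall>n\<ge>N. d \<le> C * \<mu> powr a + D \<mu> * (3 / 4) ^ n"
      using le that by blast
  qed
  \<comment> \<open>With this choice \<open>\<bar>C\<bar> * \<mu> powr a\<close> is at most \<open>d / 2\<close>.\<close>
  define \<mu> where "\<mu> = (d / (2 * (\<bar>C\<bar> + 1))) powr (1 / a)"
  have pos: "d / (2 * (\<bar>C\<bar> + 1)) > 0"
    using \<open>d > 0\<close> by simp
  then have "\<mu> > 0"
    unfolding \<mu>_def by (metis less_numeral_extra(3) powr_gt_zero)
  then have "d \<le> C * \<mu> powr a"
    by (rule *)
  also have "\<mu> powr a = d / (2 * (\<bar>C\<bar> + 1))"
    using \<open>d > 0\<close> \<open>a > 0\<close> by (simp add: \<mu>_def powr_powr)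
  also have "C * (d / (2 * (\<bar>C\<bar> + 1))) \<le> (\<bar>C\<bar> + 1) * (d / (2 * (\<bar>C\<bar> + 1)))"
    using pos by (intro mult_right_mono) auto
  also have "\<dots> = d / 2"
    by (simp add: field_simps)
  finally show False
    using \<open>d > 0\<close> by simp
qed

text \<open>
  A large fourth moment is needed to keep the second moment at 1 while a lower moment stays bounded;
  but the fourth moments tend to 0.
\<close>

lemma trig_moment_unbounded:
  assumes "0 \<le> r" "r < 2"
  shows "\<not> (\<forall>n. trig_moment r n \<le> C)"
proof
  assume C: "\<forall>n. trig_moment r n \<le> C"
  have "1 \<le> C * \<mu> powr (2 - r) + \<mu> powr - 2 * (3 / 4) ^ n" if "\<mu> > 0" for \<mu> :: real and n
  proof -
    have "trig_moment 2 n \<le> \<mu> powr (2 - r) * trig_moment r n + \<mu> powr - 2 * trig_moment 4 n"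
      using assms that by (intro trig_moment_interpolate interpolate_second) auto
    also have "\<dots> \<le> \<mu> powr (2 - r) * C + \<mu> powr - 2 * (3 / 4) ^ n"
      using C trig_moment_4 by (intro add_mono mult_left_mono) auto
    finally show ?thesis
      by (simp add: trig_moment_2 mult.commute)
  qed
  then show False
    using assms by (intro no_vanishing_bound [of 1 "2 - r" C "\<lambda>\<mu>. \<mu> powr - 2"]) auto
qed

text \<open>
  Higher moments are dominated by the second moment with a small factor and the fourth moment, which
  tends to 0.
\<close>

lemma trig_moment_not_bounded_below:
  assumes "2 < r" "d > 0"
  shows "\<not> (\<forall>n. d \<le> trig_moment r n)"
proof
  assume d: "\<forall>n. d \<le> trig_moment r n"
  have "d \<le> 1 * \<mu> powr (r - 2) + \<mu> powr - 4 * (3 / 4) ^ n" if "\<mu> > 0" for \<mu> :: real and n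
  proof -
    have "d \<le> trig_moment r n"
      using d by blast
    also have "\<dots> \<le> \<mu> powr (r - 2) * trig_moment 2 n + \<mu> powr - 4 * trig_moment 4 n"
      using assms that by (intro trig_moment_interpolate interpolate_high) auto
    also have "\<dots> \<le> \<mu> powr (r - 2) * 1 + \<mu> powr - 4 * (3 / 4) ^ n"
      using trig_moment_4 by (intro add_mono mult_left_mono) (auto simp: trig_moment_2)
    finally show ?thesis
      by simp
  qed
  then show False
    using assms by (intro no_vanishing_bound [of d "r - 2" 1 "\<lambda>\<mu>. \<mu> powr - 4"]) auto
qed

section \<open>Non-equivalence\<close>

theorem not_Lp_equivalent_trig_walsh:
  assumes \<sigma>: "dyadically_linear \<sigma>" and p: "1 \<le> p" "p \<noteq> 2"
  shows "\<not> Lp_equivalent p trig (\<lambda>k. walsh (\<sigma> k))"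
proof
  assume equiv: "Lp_equivalent p trig (\<lambda>k. walsh (\<sigma> k))"
  show False
  proof (cases p)
    case (real r)
    with p have r: "1 \<le> r" "r \<noteq> 2"
      by auto
    then have "0 < r"
      by simp
    have equiv': "Lp_equivalent (ereal r) trig (\<lambda>k. walsh (\<sigma> k))"
      using equiv real by simp
    obtain C where C: "C > 0" "\<And>n. trig_moment r n \<le> C" "\<And>n. 1 \<le> C * trig_moment r n"
      by (rule trig_moment_bounds_of_equivalent [OF \<sigma> \<open>0 < r\<close> equiv']) blast
    show False
    proof (cases "r < 2")
      case True
      then show False
        using trig_moment_unbounded [of r C] C(2) r by simp
    next
      case False
      have "\<forall>n. 1 / C \<le> trig_moment r n"
        using C(1,3) by (simp add: divide_le_eq mult.commute)
      then show False
        using trig_moment_not_bounded_below [of r "1 / C"] False r C(1) by simp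
    qed
  next
    case PInf
    then have equiv': "Lp_equivalent \<infinity> trig (\<lambda>k. walsh (\<sigma> k))"
      using equiv by simp
    obtain C where "\<And>n. trig_moment 1 n \<le> C"
      by (rule trig_moment_1_bound_of_equivalent_infinity [OF \<sigma> equiv']) blast
    then show False
      using trig_moment_unbounded [of 1 C] by simp
  next
    case MInf
    then show False
      using p by simp
  qed
qed

lemma dyadically_linear_id: "dyadically_linear id"
  by (simp add: dyadically_linear_def)

text \<open>
  This is the Gray code \<open>n XOR (n div 2)\<close>. Digits of \<open>d\<close> are constant if its image is 0, and finitely
  many are 1, so \<open>d = 0\<close>; this gives injectivity. As no digit is set above the leading one, each \<open>{..<2 ^ n}\<close> is mapped to
  itself, hence onto itself.
\<close>

lemma dyadically_linear_original_walsh_perm: "dyadically_linear original_walsh_perm"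
proof -
  let ?\<sigma> = original_walsh_perm
  have add: "?\<sigma> (m XOR n) = ?\<sigma> m XOR ?\<sigma> n" for m n
    by (rule bit_eqI) (auto simp: bit_xor_iff bit_original_walsh_perm)
  have less: "?\<sigma> k < 2 ^ n" if "k < 2 ^ n" for k n
  proof -
    have k: "\<not> bit k i" if "i \<ge> n" for i
      using \<open>k < 2 ^ n\<close> that by (metis bit_take_bit_iff not_le take_bit_nat_eq_self_iff)
    have "take_bit n (?\<sigma> k) = ?\<sigma> k"
    proof (rule bit_eqI)
      fix i
      show "bit (take_bit n (?\<sigma> k)) i \<longleftrightarrow> bit (?\<sigma> k) i"
        using k [of i] k [of "i + 1"]
        by (cases "i < n") (simp_all add: bit_take_bit_iff bit_original_walsh_perm)
    qed
    then show ?thesis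
      by (simp add: take_bit_nat_eq_self_iff)
  qed
  have "inj ?\<sigma>"
  proof (rule injI)
    fix m n assume eq: "?\<sigma> m = ?\<sigma> n"
    define d where "d = m XOR n"
    have "?\<sigma> d = 0"
      by (simp add: d_def add eq)
    then have step: "bit d i \<longleftrightarrow> bit d (i + 1)" for i
      by (metis bit_original_walsh_perm bit_0_eq bot_apply bot_bool_def)
    have const: "bit d (i + j) \<longleftrightarrow> bit d i" for i j
      by (induction j) (use step in auto)
    have "\<not> bit d i" for i
    proof
      assume "bit d i"
      then have "range (\<lambda>j. i + j) \<subseteq> {j. bit d j}"
        using const by auto
      then have "finite (range (\<lambda>j. i + j))"
        using finite_bits_nat finite_subset by blast
      then show False
        using finite_imageD [of "\<lambda>j. i + j" UNIV] by (simp add: inj_on_def)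
    qed
    then have "d = 0"
      by (intro bit_eqI) simp
    then show "m = n"
      unfolding d_def by (metis xor_nat_cancel xor.left_neutral)
  qed
  moreover have "surj ?\<sigma>"
  proof -
    have "y \<in> range ?\<sigma>" for y
    proof -
      have "?\<sigma> ` {..<2 ^ y} = {..<2 ^ y}"
        by (rule card_subset_eq)
           (use less \<open>inj ?\<sigma>\<close> in \<open>auto simp: card_image inj_on_subset\<close>)
      moreover have "y < 2 ^ y"
        by (rule less_exp)
      ultimately show ?thesis
        by blast
    qed
    then show ?thesis
      by blast
  qed
  ultimately show ?thesis
    using add by (simp add: dyadically_linear_def bij_def)
qed

theorem theorem5p4:
  shows "(\<forall>\<sigma>. dyadically_linear \<sigma> \<longrightarrow>
            (\<forall>n. card (A_set \<sigma> n) \<le> 6 ^ n) \<and>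
            (\<forall>p. 1 \<le> p \<and> p \<noteq> 2 \<longrightarrow> \<not> Lp_equivalent p trig (\<lambda>k. walsh (\<sigma> k)))) \<and>
         (\<forall>p. 1 \<le> p \<and> p \<noteq> 2 \<longrightarrow>
            \<not> Lp_equivalent p walsh trig \<and>
            \<not> Lp_equivalent p (\<lambda>k. walsh (original_walsh_perm k)) trig)"
proof (intro conjI allI impI)
  fix \<sigma> :: "nat \<Rightarrow> nat" and n assume "dyadically_linear \<sigma>"
  then show "card (A_set \<sigma> n) \<le> 6 ^ n"
    by (simp only: A_set_dyadically_linear card_A_set_id)
next
  fix \<sigma> and p :: ereal assume "dyadically_linear \<sigma>" "1 \<le> p \<and> p \<noteq> 2"
  then show "\<not> Lp_equivalent p trig (\<lambda>k. walsh (\<sigma> k))"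
    by (simp add: not_Lp_equivalent_trig_walsh)
next
  fix p :: ereal assume "1 \<le> p \<and> p \<noteq> 2"
  then have "\<not> Lp_equivalent p trig (\<lambda>k. walsh (id k))"
    by (simp only: not_Lp_equivalent_trig_walsh [OF dyadically_linear_id] not_False_eq_True)
  then show "\<not> Lp_equivalent p walsh trig"
    using Lp_equivalent_sym [of p walsh trig] by auto
next
  fix p :: ereal assume "1 \<le> p \<and> p \<noteq> 2"
  then have "\<not> Lp_equivalent p trig (\<lambda>k. walsh (original_walsh_perm k))"
    by (simp only: not_Lp_equivalent_trig_walsh [OF dyadically_linear_original_walsh_perm]
        not_False_eq_True)
  then show "\<not> Lp_equivalent p (\<lambda>k. walsh (original_walsh_perm k)) trig"
    using Lp_equivalent_sym by metis
qed

end
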